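(* Let $n$ be a nonnegative integer and let $\zeta\in\mathbb{C}$ be a primitive $(6n+4)$-th root of unity. Then $$\mathrm{Re}\left(\sum_{k=1}^{2n+1}\frac{\zeta^{k(3k+1)/2}}{1-\zeta^{3k}}\right)=-\frac{n+1}{2}.$$
   Context: $\mathrm{Re}$ denotes the real part. The exponent $k(3k+1)/2$ is an integer for every integer $k$. *)

theory Defs
  imports Complex_Main
begin

definition primitive_root_of_unity :: "nat \<Rightarrow> 'a::monoid_mult \<Rightarrow> bool" where
  "primitive_root_of_unity m z \<longleftrightarrow>
     m > 0 \<and> z ^ m = 1 \<and> (\<forall>j. 0 < j \<and> j < m \<longrightarrow> z ^ j \<noteq> 1)"

(* The truncating division in exponents of the form k (3k+1) / 2 is exact. *)
lemma even_mult_three_plus_one: "even (k * (3 * k + 1))" for k :: nat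
  by simp

end

theory Submission
  imports Defs
begin

text \<open>
  Put \<open>N = 2 n + 1\<close>, \<open>M = 3 N + 1\<close> and \<open>c s = \<zeta> ^ (s (3 s + 1) / 2)\<close>. Since \<open>\<zeta> ^ M = 1\<close>, twice the
  real part of the \<open>k\<close>-th summand is a finite geometric sum, namely the \<open>k\<close>-th autocorrelation
  \<open>\<Sum>i\<le>N - k. c (k + i) * cnj (c i)\<close> of the sequence \<open>c 0, \<dots>, c N\<close>. Summing over \<open>k\<close> gives half of
  \<open>\<bar>\<Sum>s\<le>N. c s\<bar>\<^sup>2 - (N + 1)\<close>, and the sum of the \<open>c s\<close> vanishes because \<open>\<zeta> ^ (M / 2) = -1\<close> and \<open>N\<close> is
  odd, whence \<open>c (N - s) = - c s\<close>.
\<close>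

text \<open>Expand the square into pairs \<open>(s, t)\<close>. The diagonal gives the squared
  norms; pairs with \<open>s > t\<close> are grouped by the lag \<open>k = s - t\<close>, and those
  with \<open>s < t\<close> are their conjugates, hence the factor 2.\<close>

lemma norm_sum_squared_autocorrelation:
  fixes c :: "nat \<Rightarrow> complex"
  shows "(cmod (\<Sum>s\<le>N. c s))\<^sup>2 =
    (\<Sum>s\<le>N. (cmod (c s))\<^sup>2) + 2 * Re (\<Sum>k=1..N. \<Sum>i\<le>N - k. c (k + i) * cnj (c i))"
proof (induction N)
  case 0
  show ?case by simp
next
  case (Suc N)
  \<comment> \<open>The new index adds one pair, \<open>(Suc N, Suc N - k)\<close>, to each lag
    \<open>k \<le> N\<close>, and opens the lag \<open>Suc N\<close> with the single pair
    \<open>(Suc N, 0)\<close>.\<close>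
  have "(\<Sum>k=1..Suc N. \<Sum>i\<le>Suc N - k. c (k + i) * cnj (c i)) =
      (\<Sum>k=1..N. (\<Sum>i\<le>N - k. c (k + i) * cnj (c i)) + c (Suc N) * cnj (c (Suc N - k)))
      + c (Suc N) * cnj (c 0)"
    by (simp add: Suc_diff_le)
  also have "\<dots> = (\<Sum>k=1..N. \<Sum>i\<le>N - k. c (k + i) * cnj (c i))
      + (\<Sum>k=1..Suc N. c (Suc N) * cnj (c (Suc N - k)))"
    by (simp add: sum.distrib)
  also have "(\<Sum>k=1..Suc N. c (Suc N) * cnj (c (Suc N - k))) = c (Suc N) * cnj (\<Sum>s\<le>N. c s)"
    unfolding sum_distrib_left cnj_sum
    by (rule sum.reindex_bij_witness[of _ "\<lambda>s. Suc N - s" "\<lambda>k. Suc N - k"]) auto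
  finally have step: "(\<Sum>k=1..Suc N. \<Sum>i\<le>Suc N - k. c (k + i) * cnj (c i)) =
      (\<Sum>k=1..N. \<Sum>i\<le>N - k. c (k + i) * cnj (c i)) + c (Suc N) * cnj (\<Sum>s\<le>N. c s)" .
  have expand: "(cmod (x + y))\<^sup>2 = (cmod x)\<^sup>2 + (cmod y)\<^sup>2 + 2 * Re (y * cnj x)" for x y
    unfolding cmod_power2 by (simp add: power2_eq_square algebra_simps)
  show ?case
    unfolding step sum.atMost_Suc expand plus_complex.sel distrib_left Suc.IH
    by (simp only: ac_simps)
qed

text \<open>The cross term \<open>3 * k * i\<close> is linear in \<open>i\<close>, so the ratio of
  \<open>c (k + i)\<close> to \<open>c i\<close> is geometric in \<open>i\<close> with ratio
  \<open>\<zeta> ^ (3 * k)\<close>. Doubling removes the exact division.\<close>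

lemma pentagonal_add:
  "(k + i) * (3 * (k + i) + 1) div 2 = k * (3 * k + 1) div 2 + i * (3 * i + 1) div 2 + 3 * k * i"
  for k i :: nat
proof -
  have e: "2 * (x * (3 * x + 1) div 2) = x * (3 * x + 1)" for x :: nat
    using even_mult_three_plus_one by (rule dvd_mult_div_cancel)
  have "2 * ((k + i) * (3 * (k + i) + 1) div 2) = (k + i) * (3 * (k + i) + 1)"
    by (rule e)
  also have "\<dots> = k * (3 * k + 1) + i * (3 * i + 1) + 2 * (3 * k * i)"
    by (simp add: algebra_simps)
  also have "\<dots> = 2 * (k * (3 * k + 1) div 2 + i * (3 * i + 1) div 2 + 3 * k * i)"
    by (simp only: e distrib_left[of 2])
  finally show ?thesis by (simp only: nat_mult_eq_cancel1 zero_less_numeral)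
qed

text \<open>Used for exponents of \<zeta>: multiples of \<open>2 * h\<close> vanish and
  \<open>N * h\<close> becomes a sign. The multiple of \<open>2 * h\<close> stands on the left to
  avoid a subtraction in the naturals.\<close>

lemma pentagonal_reflect:
  fixes N s h :: nat
  assumes "s \<le> N" and "3 * N + 1 = 2 * h"
  shows "(N - s) * (3 * (N - s) + 1) div 2 + s * (2 * h) = s * (3 * s + 1) div 2 + N * h"
proof -
  obtain r where r: "N = s + r" using assms(1) le_Suc_ex by blast
  have e: "2 * (x * (3 * x + 1) div 2) = x * (3 * x + 1)" for x :: nat
    using even_mult_three_plus_one by (rule dvd_mult_div_cancel)
  have "2 * ((N - s) * (3 * (N - s) + 1) div 2 + s * (2 * h)) =
      r * (3 * r + 1) + 2 * s * (3 * N + 1)"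
    using e[of r] assms(2) r by simp
  also have "\<dots> = s * (3 * s + 1) + N * (3 * N + 1)"
    unfolding r by (simp add: algebra_simps)
  also have "\<dots> = 2 * (s * (3 * s + 1) div 2 + N * h)"
    using e[of s] assms(2) by simp
  finally show ?thesis by simp
qed

text \<open>On the unit circle conjugation is inversion, so the conjugate of
  \<open>u / (1 - w)\<close> is \<open>- w * cnj u / (1 - w)\<close>. The hypothesis
  \<open>close\<close> says \<open>cnj u = u * w ^ d\<close>, so adding the two closes a geometric
  series of \<open>d + 1\<close> terms.\<close>

lemma Re_divide_one_minus_eq_geometric_sum:
  fixes u w :: complex
  assumes "cmod u = 1" "cmod w = 1" "w \<noteq> 1" and close: "u\<^sup>2 * w ^ d = 1"
  shows "2 * Re (u / (1 - w)) = Re (\<Sum>i\<le>d. u * w ^ i)"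
proof -
  have cu: "cnj u * u = 1" and cw: "cnj w * w = 1"
    using assms(1,2) by (simp_all add: complex_norm_square[symmetric] mult.commute)
  have nz: "1 - w \<noteq> 0" "1 - cnj w \<noteq> 0"
    using assms(3) by (simp, metis complex_cnj_cnj complex_cnj_one eq_iff_diff_eq_0)
  have "cnj u = cnj u * (u\<^sup>2 * w ^ d)" using close by simp
  also have "\<dots> = u * w ^ d" using cu by (simp add: power2_eq_square algebra_simps)
  finally have cnj_u: "cnj u = u * w ^ d" .
  have "(1 - w) * cnj u = - (w * cnj u) * (1 - cnj w)"
    using cw by (simp add: algebra_simps)
  then have "cnj u / (1 - cnj w) = - (w * cnj u) / (1 - w)"
    using nz by (subst frac_eq_eq) (simp_all only: mult.commute not_False_eq_True simp_thms)
  then have "u / (1 - w) + cnj (u / (1 - w)) = u * ((1 - w ^ Suc d) / (1 - w))"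
    by (simp add: cnj_u algebra_simps add_divide_distrib[symmetric] diff_divide_distrib[symmetric])
  also have "\<dots> = (\<Sum>i\<le>d. u * w ^ i)"
    using assms(3) by (simp add: sum_gp0 sum_distrib_left[symmetric])
  finally have "Re (u / (1 - w) + cnj (u / (1 - w))) = Re (\<Sum>i\<le>d. u * w ^ i)"
    by (rule arg_cong)
  then show ?thesis by (simp only: plus_complex.sel cnj.sel mult_2)
qed

lemma primitive_root_power_half:
  fixes z :: "'a::idom"
  assumes "primitive_root_of_unity (2 * h) z"
  shows "z ^ h = - 1"
proof -
  have "(z ^ h)\<^sup>2 = 1" "z ^ h \<noteq> 1"
    using assms by (auto simp: primitive_root_of_unity_def power_mult[symmetric] mult.commute)
  then show ?thesis by (auto simp: power2_eq_1_iff)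
qed

theorem corollary2:
  fixes n :: nat and \<zeta> :: complex
  assumes "primitive_root_of_unity (6 * n + 4) \<zeta>"
  shows "Re (\<Sum>k = 1..2 * n + 1. \<zeta> ^ (k * (3 * k + 1) div 2) / (1 - \<zeta> ^ (3 * k)))
           = - (real n + 1) / 2"
proof -
  define N where "N = 2 * n + 1"
  define h where "h = 3 * n + 2"
  define c where "c s = \<zeta> ^ (s * (3 * s + 1) div 2)" for s
  have Nh: "3 * N + 1 = 2 * h" by (simp add: N_def h_def)
  have "2 * h = 6 * n + 4" by (simp add: h_def)
  with assms have prim: "primitive_root_of_unity (2 * h) \<zeta>" by (simp only:)
  have root: "\<zeta> ^ (2 * h) = 1" and nontriv: "\<And>j. 0 < j \<Longrightarrow> j < 2 * h \<Longrightarrow> \<zeta> ^ j \<noteq> 1"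
    using prim unfolding primitive_root_of_unity_def by blast+
  have half: "\<zeta> ^ h = - 1" using prim by (rule primitive_root_power_half)
  have norm_zeta: "cmod \<zeta> = 1"
    using power_eq_1_iff[OF root] by (simp add: h_def)
  have norm_c: "cmod (c s) = 1" for s by (simp add: c_def norm_power norm_zeta)
  have c_add: "c (k + i) = c k * c i * (\<zeta> ^ (3 * k)) ^ i" for k i
    unfolding c_def pentagonal_add by (simp add: power_add power_mult)
  have c_cnj: "c s * cnj (c s) = 1" for s
    using norm_c[of s] by (simp add: complex_norm_square[symmetric])

  have "c (N - s) = - c s" if "s \<le> N" for s
  proof -
    \<comment> \<open>The left power is 1, and the right one is \<open>(- 1) ^ N = - 1\<close>
      because \<open>N\<close> is odd.\<close>
    have "c (N - s) * (\<zeta> ^ (2 * h)) ^ s = c s * (\<zeta> ^ h) ^ N"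
      using arg_cong[OF pentagonal_reflect[OF that Nh], of "\<lambda>x. \<zeta> ^ x"] unfolding c_def
      by (simp only: power_add power_mult[symmetric] mult.commute[of N h] mult.commute[of s "2 * h"])
    then show ?thesis by (simp add: root half N_def)
  qed
  then have "(\<Sum>s\<le>N. c (N - s)) = (\<Sum>s\<le>N. - c s)" by (intro sum.cong) auto
  moreover have "(\<Sum>s\<le>N. c (N - s)) = (\<Sum>s\<le>N. c s)"
    by (rule sum.reindex_bij_witness[of _ "\<lambda>s. N - s" "\<lambda>s. N - s"]) auto
  ultimately have sum_c: "(\<Sum>s\<le>N. c s) = 0" by (simp add: sum_negf)

  have summand: "2 * Re (c k / (1 - \<zeta> ^ (3 * k))) = Re (\<Sum>i\<le>N - k. c (k + i) * cnj (c i))"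
    if k: "k \<in> {1..N}" for k
  proof -
    \<comment> \<open>This is \<open>close\<close> for \<open>d = N - k\<close>: the exponent equals
      \<open>k * (3 * N + 1)\<close>, a multiple of the order of \<zeta>.\<close>
    have "(c k)\<^sup>2 * (\<zeta> ^ (3 * k)) ^ (N - k) = \<zeta> ^ (k * (3 * k + 1) + 3 * k * (N - k))"
      unfolding c_def power_add power_mult[symmetric]
      using even_mult_three_plus_one[of k] by (simp only: dvd_div_mult_self)
    also have "k * (3 * k + 1) + 3 * k * (N - k) = 2 * h * k"
    proof -
      obtain r where "N = k + r" using k le_Suc_ex by auto
      then show ?thesis unfolding Nh[symmetric] by (simp add: algebra_simps)
    qed
    finally have "(c k)\<^sup>2 * (\<zeta> ^ (3 * k)) ^ (N - k) = 1" 
      by (simp only: power_mult[of \<zeta> "2 * h"] root power_one)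
    moreover have "\<zeta> ^ (3 * k) \<noteq> 1" using k Nh by (intro nontriv) auto
    ultimately have "2 * Re (c k / (1 - \<zeta> ^ (3 * k))) = Re (\<Sum>i\<le>N - k. c k * (\<zeta> ^ (3 * k)) ^ i)"
      by (intro Re_divide_one_minus_eq_geometric_sum)
        (auto simp: norm_c norm_power norm_zeta)
    moreover have "c k * (\<zeta> ^ (3 * k)) ^ i = c (k + i) * cnj (c i)" for i
      using c_cnj[of i] by (simp add: c_add)
    ultimately show ?thesis by (simp only:)
  qed

  have "2 * Re (\<Sum>k=1..N. c k / (1 - \<zeta> ^ (3 * k))) =
      Re (\<Sum>k=1..N. \<Sum>i\<le>N - k. c (k + i) * cnj (c i))"
    unfolding Re_sum[of _ "{1..N}"] sum_distrib_left by (intro sum.cong refl summand)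
  \<comment> \<open>The vanishing sum leaves the \<open>N + 1\<close> unit diagonal terms against
    twice the lag sum. As the lag sum is itself twice the wanted real part, the value is
    \<open>- (N + 1) / 4\<close> with \<open>N + 1 = 2 * (n + 1)\<close>.\<close>
  moreover have "0 = real N + 1 + 2 * Re (\<Sum>k=1..N. \<Sum>i\<le>N - k. c (k + i) * cnj (c i))"
    using norm_sum_squared_autocorrelation[of c N] by (simp add: sum_c norm_c)
  ultimately show ?thesis
    unfolding c_def N_def by simp
qed

end
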